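(* Let $f:\mathbb{R}^n\to[0,\infty)$ be an integrable quasi-concave function. Let $\mu$ be a measure on $\mathbb{R}^n$ given by $d\mu(x)=\phi(x)\,dx$, where $\phi:\mathbb{R}^n\to[0,\infty)$ is radially decreasing. Then $$\int_{\mathbb{R}^n}\Delta_{-\infty}f(x)\,d\mu(x)\le\binom{2n}{n}\int_0^\infty\min\Bigl\{\overline{\mu}\bigl(S_{\ge t}(f)\bigr),\overline{\mu}\bigl(-S_{\ge t}(f)\bigr)\Bigr\}\,dt.$$ In particular, choosing $\mu$ to be the Lebesgue measure, $$\int_{\mathbb{R}^n}\Delta_{-\infty}f(x)\,dx\le\binom{2n}{n}\int_{\mathbb{R}^n}f(x)\,dx.$$
   Context: $f$ is quasi-concave if $f((1-\lambda)x+\lambda y)\ge\min\{f(x),f(y)\}$ for all $x,y\in\mathbb{R}^n$, $\lambda\in(0,1)$. $\phi$ is (measurable and) radially decreasing if $\phi(tx)\ge\phi(x)$ for all $t\in[0,1]$, $x\in\mathbb{R}^n$. The $(-\infty)$-difference of $f$ is $$\Delta_{-\infty}f(z)=\sup_{z=x-y}\min\{f(x),f(y)\}.$$ $S_{\ge t}(f)=\{x\in\mathbb{R}^n:f(x)\ge t\}$. For a bounded convex set $A$ with positive volume, $\overline{\mu}(A)=\frac1{\mathrm{vol}(A)}\int_A\mu(-y+A)\,dy$; set $\overline{\mu}(A)=0$ when $\mathrm{vol}(A)=0$. *)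

theory Defs
  imports "HOL-Analysis.Analysis"
begin

definition quasi_concave :: "('a::real_vector \<Rightarrow> real) \<Rightarrow> bool" where
  "quasi_concave f \<longleftrightarrow>
     (\<forall>x y. \<forall>l\<in>{0<..<1}. min (f x) (f y) \<le> f ((1 - l) *\<^sub>R x + l *\<^sub>R y))"

definition radially_decreasing :: "('a::real_vector \<Rightarrow> real) \<Rightarrow> bool" where
  "radially_decreasing \<phi> \<longleftrightarrow> (\<forall>x. \<forall>t\<in>{0..1}. \<phi> x \<le> \<phi> (t *\<^sub>R x))"

definition superlevel :: "('a \<Rightarrow> real) \<Rightarrow> real \<Rightarrow> 'a set" where
  "superlevel f t = {x. t \<le> f x}"

(* The (-infinity)-difference of a nonnegative f. It takes values in [0,\<infinity>] because an
   integrable quasi-concave function may be unbounded, in which case the supremum at z = 0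
   is infinite. *)
definition min_difference :: "('a::ab_group_add \<Rightarrow> real) \<Rightarrow> 'a \<Rightarrow> ennreal" where
  "min_difference f z = (SUP (x, y) \<in> {(x, y). z = x - y}. ennreal (min (f x) (f y)))"

(* The average of M(-y + A) over y in A. The notion is meant for bounded convex A. The
   superlevel sets, at positive heights, of an integrable quasi-concave function are convex
   of finite volume, hence bounded or of volume zero. *)
definition translate_average :: "'a::euclidean_space measure \<Rightarrow> 'a set \<Rightarrow> ennreal" where
  "translate_average M A =
     (if emeasure lebesgue A = 0 then 0
      else (\<integral>\<^sup>+y\<in>A. emeasure M ((\<lambda>x. - y + x) ` A) \<partial>lebesgue) / emeasure lebesgue A)"

end

theory Submission
  imports Defs
begin

text \<open>
  The set where \<open>\<Delta>\<^sub>-\<^sub>\<infinity> f > t\<close> is the difference body of \<open>{f > t}\<close>, hence lies in \<open>A - A\<close> for the convex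
  set \<open>A = {f \<ge> t}\<close>, which has finite volume because \<open>f\<close> is integrable. Integrating over the levels
  \<open>t\<close> reduces the functional inequality to the statement about sets
  \<open>\<mu>(A - A) \<le> (2n choose n) \<mu>'(A)\<close>, where \<open>\<mu>'(A)\<close> is the average of \<open>\<mu>(A - y)\<close> over \<open>y \<in> A\<close>
  (lemma \<open>emeasure_difference_body_le\<close>). The same bound with \<open>\<mu>'(-A)\<close> is the case of the set \<open>-A\<close>,
  which has the same difference body.

  For sets, put \<open>D = A - A\<close>. By Tonelli, \<open>vol(A) \<mu>'(A)\<close> is the integral of
  \<open>\<phi>(x) vol(A \<inter> (A - x))\<close> over \<open>x\<close>. If \<open>x = (1 - u)(a - b)\<close> with \<open>a, b \<in> A\<close>, then convexity places
  \<open>u A + (1 - u) b\<close> inside \<open>A \<inter> (A - x)\<close>, so that this overlap has at least the fraction \<open>u^n\<close> of the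
  volume of \<open>A\<close> (\<open>overlap_lower_bound\<close>). Writing the fraction as the integral of its density
  \<open>n u^(n-1)\<close> turns this into
  \<open>\<mu>'(A) \<ge> \<integral> n u^(n-1) \<mu>((1 - u) D) du\<close> over the unit interval (\<open>overlap_weight_bound\<close>).
  A radially decreasing density satisfies \<open>\<mu>(c D) \<ge> c^n \<mu>(D)\<close> for \<open>0 < c \<le> 1\<close>, by substituting
  \<open>x = c y\<close> (\<open>radially_decreasing_nn_integral_scaleR\<close>), and the remaining Beta integral
  \<open>\<integral> n u^(n-1) (1 - u)^n du\<close> is the reciprocal of \<open>2n choose n\<close> (\<open>nn_integral_beta_weight\<close>).

  A convex set differs from its interior by a null set. Therefore \<open>A\<close> and \<open>D\<close> are replaced by open
  sets wherever a set is pulled back along \<open>(x, y) \<mapsto> x + y\<close> or \<open>(x, u) \<mapsto> x / (1 - u)\<close>: for a Borel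
  set this preimage is measurable in the product space, for a general Lebesgue set it need not be.
\<close>

section \<open>Convex sets and Lebesgue measure\<close>

definition difference_body :: "'a::ab_group_add set \<Rightarrow> 'a set" where
  "difference_body A = {x - y | x y. x \<in> A \<and> y \<in> A}"

lemma difference_body_uminus: "difference_body (uminus ` A) = difference_body A"
proof -
  have "- a - - b = b - a" for a b :: 'a by simp
  then have "difference_body (uminus ` A) = {b - a |a b. a \<in> A \<and> b \<in> A}"
    unfolding difference_body_def image_iff by metis
  then show ?thesis unfolding difference_body_def by blast
qed

lemma difference_body_mono: "A \<subseteq> B \<Longrightarrow> difference_body A \<subseteq> difference_body B"
  unfolding difference_body_def by blast

lemma convex_difference_body: "convex A \<Longrightarrow> convex (difference_body A)"
proof -
  assume "convex A"
  moreover have "difference_body A = (\<Union>x\<in>A. \<Union>y\<in>A. {x - y})"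
    unfolding difference_body_def by blast
  ultimately show ?thesis using convex_differences[of A A] by simp
qed

lemma convex_diff_interior_null_sets:
  fixes A :: "'a::euclidean_space set"
  assumes "convex A"
  shows "A - interior A \<in> null_sets lebesgue"
proof -
  have "A - interior A \<subseteq> frontier A"
    using closure_subset[of A] unfolding frontier_def by blast
  then show ?thesis
    using negligible_convex_frontier[OF assms] negligible_subset negligible_iff_null_sets by blast
qed

text \<open>A convex set is an open set together with a part of its null frontier.\<close>

lemma convex_sets_lebesgue:
  fixes A :: "'a::euclidean_space set"
  assumes "convex A"
  shows "A \<in> sets lebesgue"
proof -
  have "A = interior A \<union> (A - interior A)"
    using interior_subset by auto
  moreover have "interior A \<in> sets lebesgue"
    using open_interior by (metis borel_open sets_completionI_sets sets_lborel)
  ultimately show ?thesis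
    using convex_diff_interior_null_sets[OF assms] by (metis null_setsD2 sets.Un)
qed

lemma emeasure_lebesgue_interior_convex:
  fixes A :: "'a::euclidean_space set"
  assumes "convex A"
  shows "emeasure lebesgue (interior A) = emeasure lebesgue A"
proof -
  have "emeasure lebesgue (A - (A - interior A)) = emeasure lebesgue A"
    by (intro emeasure_Diff_null_set convex_diff_interior_null_sets convex_sets_lebesgue assms)
  also have "A - (A - interior A) = interior A"
    using interior_subset by auto
  finally show ?thesis .
qed

text \<open>
  The degenerate levels: a null convex set lies in an affine hyperplane, so its differences lie in
  the parallel linear hyperplane. This matches the convention that the average over a null set is 0.
\<close>

lemma negligible_difference_body:
  fixes A :: "'a::euclidean_space set"
  assumes "convex A" "negligible A"
  shows "negligible (difference_body A)"
proof -
  have "interior A = {}"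
    using assms negligible_convex_interior by blast
  then obtain a b where "a \<noteq> 0" and A: "A \<subseteq> {x. a \<bullet> x = b}"
    using empty_interior_subset_hyperplane[OF assms(1)] by metis
  have "difference_body A \<subseteq> {x. a \<bullet> x = 0}"
    using A unfolding difference_body_def by (auto simp: inner_diff_right subset_eq)
  then show ?thesis
    using negligible_hyperplane[of a 0] \<open>a \<noteq> 0\<close> negligible_subset by blast
qed

lemma sigma_finite_lebesgue: "sigma_finite_measure (lebesgue :: 'a::euclidean_space measure)"
proof
  obtain F :: "'a set set" where F: "countable F" "F \<subseteq> sets lborel" "\<Union>F = space lborel"
      "\<forall>a\<in>F. emeasure lborel a \<noteq> \<infinity>"
    using lborel.sigma_finite_countable by blast
  have "F \<subseteq> sets lebesgue" "\<forall>a\<in>F. emeasure lebesgue a \<noteq> \<infinity>"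
    using F by (auto simp: subset_eq)
  with F show "\<exists>F :: 'a set set. countable F \<and> F \<subseteq> sets lebesgue \<and> \<Union>F = space lebesgue \<and>
      (\<forall>a\<in>F. emeasure lebesgue a \<noteq> \<infinity>)"
    by (intro exI[of _ F]) auto
qed

lemma nn_integral_lebesgue_scaleR:
  fixes F :: "'a::euclidean_space \<Rightarrow> ennreal"
  assumes F[measurable]: "F \<in> borel_measurable lebesgue" and c: "0 < c"
  shows "(\<integral>\<^sup>+x. F x \<partial>lebesgue) = ennreal (c ^ DIM('a)) * (\<integral>\<^sup>+x. F (c *\<^sub>R x) \<partial>lebesgue)"
proof -
  have T: "(\<lambda>x::'a. 0 + (\<Sum>j\<in>Basis. (c * (x \<bullet> j)) *\<^sub>R j)) = (\<lambda>x. c *\<^sub>R x)"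
    unfolding scaleR_scaleR[symmetric] scaleR_sum_right[symmetric] euclidean_representation by simp
  have "(lebesgue :: 'a measure) =
      density (distr lebesgue lebesgue (\<lambda>x. c *\<^sub>R x)) (\<lambda>_. ennreal (c ^ DIM('a)))"
    using lebesgue_affine_euclidean[of "\<lambda>_. c" "0 :: 'a"] c unfolding T by simp
  then have "(\<integral>\<^sup>+x. F x \<partial>lebesgue) =
      (\<integral>\<^sup>+x. F x \<partial>density (distr lebesgue lebesgue (\<lambda>x. c *\<^sub>R x)) (\<lambda>_. ennreal (c ^ DIM('a))))"
    by metis
  also have "\<dots> = (\<integral>\<^sup>+x. ennreal (c ^ DIM('a)) * F x \<partial>distr lebesgue lebesgue (\<lambda>x. c *\<^sub>R x))"
    by (subst nn_integral_density) auto
  also have "\<dots> = ennreal (c ^ DIM('a)) * (\<integral>\<^sup>+x. F (c *\<^sub>R x) \<partial>lebesgue)"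
    by (subst nn_integral_distr) (auto intro!: nn_integral_cmult measurable_compose[OF lebesgue_measurable_scaling])
  finally show ?thesis .
qed

section \<open>The binomial constant\<close>

text \<open>
  Used with \<open>r\<close> the \<open>n\<close>-th root of a volume fraction: it spreads the fraction \<open>r ^ n\<close> over the
  parameter \<open>u\<close>.
\<close>

lemma nn_integral_power_weight:
  assumes "0 \<le> (r::real)" "0 < n"
  shows "(\<integral>\<^sup>+u. ennreal (real n * u ^ (n - 1)) * indicator {0..r} u \<partial>lborel) = ennreal (r ^ n)"
proof -
  have "(\<integral>\<^sup>+u. ennreal (real n * u ^ (n - 1)) * indicator {0..r} u \<partial>lborel) = ennreal (r ^ n - 0 ^ n)"
    using assms(1) by (intro nn_integral_FTC_Icc) (auto intro!: derivative_eq_intros)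
  then show ?thesis using assms by simp
qed

text \<open>The integral is \<open>n B(n, n + 1) = n! n! / (2n)!\<close>.\<close>

lemma nn_integral_beta_weight:
  assumes n: "0 < n"
  shows "of_nat ((2 * n) choose n) *
    (\<integral>\<^sup>+u. ennreal (real n * u ^ (n - 1)) * ennreal ((1 - u) ^ n) * indicator {0<..<1} u \<partial>lborel) = 1"
proof -
  have "((\<lambda>t. t powr (real n - 1) * (1 - t) powr (real (Suc n) - 1)) has_integral
      Beta (real n) (real (Suc n))) {0<..<1}"
    using has_integral_Beta_real[of "real n" "real (Suc n)"] n by (simp add: has_integral_Icc_iff_Ioo)
  then have "((\<lambda>t. real n * (t powr (real n - 1) * (1 - t) powr (real (Suc n) - 1))) has_integral
      real n * Beta (real n) (real (Suc n))) {0<..<1}"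
    by (rule has_integral_mult_right)
  moreover have eq: "real n * (t powr (real n - 1) * (1 - t) powr (real (Suc n) - 1)) =
      real n * t ^ (n - 1) * (1 - t) ^ n" if "t \<in> {0<..<1}" for t :: real
  proof -
    have "t powr (real n - 1) = t ^ (n - 1)"
      using that n powr_realpow[of t "n - 1"] by (simp add: of_nat_diff)
    moreover have "(1 - t) powr (real (Suc n) - 1) = (1 - t) ^ n"
      using that powr_realpow[of "1 - t" n] by simp
    ultimately show ?thesis by simp
  qed
  ultimately have "((\<lambda>t. real n * t ^ (n - 1) * (1 - t) ^ n) has_integral
      real n * Beta (real n) (real (Suc n))) {0<..<1}"
    by (subst (asm) has_integral_cong[OF eq])
  from nn_integral_has_integral_lebesgue[OF _ this]
  have "(\<integral>\<^sup>+u. ennreal (indicator {0<..<1} u * (real n * u ^ (n - 1) * (1 - u) ^ n)) \<partial>lborel) =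
      ennreal (real n * Beta (real n) (real (Suc n)))"
    by auto
  also have "(\<integral>\<^sup>+u. ennreal (indicator {0<..<1} u * (real n * u ^ (n - 1) * (1 - u) ^ n)) \<partial>lborel) =
      (\<integral>\<^sup>+u. ennreal (real n * u ^ (n - 1)) * ennreal ((1 - u) ^ n) * indicator {0<..<1} u \<partial>lborel)"
    by (intro nn_integral_cong) (auto simp: indicator_def ennreal_mult)
  finally have I: "(\<integral>\<^sup>+u. ennreal (real n * u ^ (n - 1)) * ennreal ((1 - u) ^ n) * indicator {0<..<1} u \<partial>lborel)
      = ennreal (real n * Beta (real n) (real (Suc n)))" .
  obtain m where m: "n = Suc m" using n not0_implies_Suc by blast
  have G: "Gamma (real (Suc k)) = fact k" for k
    using Gamma_fact[of k, where 'a = real] by (simp add: add.commute)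
  have "real n + real (Suc n) = real (Suc (2 * n))" by simp
  then have "Beta (real n) (real (Suc n)) = fact m * fact n / fact (2 * n)"
    unfolding Beta_def by (metis G m)
  moreover have "real n * fact m = fact n"
    using m by simp
  ultimately have "real n * Beta (real n) (real (Suc n)) = fact n * fact n / fact (2 * n)"
    by (metis mult.assoc times_divide_eq_right)
  moreover have "real ((2 * n) choose n) = fact (2 * n) / (fact n * fact n)"
    using binomial_fact[of n "2 * n", where 'a = real] by (simp add: mult_2)
  ultimately have "real ((2 * n) choose n) * (real n * Beta (real n) (real (Suc n))) = 1"
    by simp
  moreover have "of_nat ((2 * n) choose n) = ennreal (real ((2 * n) choose n))"
    by (simp add: ennreal_of_nat_eq_real_of_nat)
  ultimately show ?thesis
    unfolding I by (simp add: ennreal_mult'[symmetric])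
qed

section \<open>A Rogers--Shephard inequality for radially decreasing densities\<close>

text \<open>
  If \<open>x = (1 - u)(a - b)\<close>, the copy \<open>u K + (1 - u) b\<close> of the interior \<open>K\<close> lies in \<open>K\<close>, and so does its
  translate by \<open>x\<close>, which is \<open>u K + (1 - u) a\<close>. The points \<open>a, b\<close> may be on the boundary of \<open>A\<close>:
  segments from an interior point stay in the interior up to their end.
\<close>

lemma overlap_lower_bound:
  fixes A :: "'a::euclidean_space set"
  assumes A: "convex A" and u: "0 < u" "u \<le> 1"
    and x: "x \<in> (*\<^sub>R) (1 - u) ` difference_body A"
  shows "ennreal (u ^ DIM('a)) * emeasure lebesgue (interior A)
    \<le> emeasure lebesgue {y \<in> interior A. x + y \<in> interior A}"
proof -
  from x obtain a b where ab: "a \<in> A" "b \<in> A" and x: "x = (1 - u) *\<^sub>R (a - b)"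
    unfolding difference_body_def by auto
  have shrink: "u *\<^sub>R k + (1 - u) *\<^sub>R c \<in> interior A" if "k \<in> interior A" "c \<in> A" for k c
    using mem_interior_convex_shrink[OF A that u] by (simp add: algebra_simps)
  have sub: "(\<lambda>k. u *\<^sub>R k + (1 - u) *\<^sub>R b) ` interior A \<subseteq> {y \<in> interior A. x + y \<in> interior A}"
  proof clarsimp
    fix k assume k: "k \<in> interior A"
    have "x + (u *\<^sub>R k + (1 - u) *\<^sub>R b) = u *\<^sub>R k + (1 - u) *\<^sub>R a"
      by (simp add: x algebra_simps)
    then show "u *\<^sub>R k + (1 - u) *\<^sub>R b \<in> interior A \<and> x + (u *\<^sub>R k + (1 - u) *\<^sub>R b) \<in> interior A"
      using shrink[OF k ab(1)] shrink[OF k ab(2)] by metis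
  qed
  have "open {y \<in> interior A. x + y \<in> interior A}"
  proof -
    have "{y \<in> interior A. x + y \<in> interior A} = interior A \<inter> (\<lambda>y. x + y) -` interior A"
      by auto
    then show ?thesis
      by (auto intro!: open_Int continuous_open_vimage continuous_intros)
  qed
  then have "{y \<in> interior A. x + y \<in> interior A} \<in> sets lebesgue"
    by (metis borel_open sets_completionI_sets sets_lborel)
  then have "emeasure lebesgue ((\<lambda>k. u *\<^sub>R k + (1 - u) *\<^sub>R b) ` interior A)
      \<le> emeasure lebesgue {y \<in> interior A. x + y \<in> interior A}"
    by (intro emeasure_mono sub)
  then show ?thesis
    using u unfolding emeasure_lebesgue_affine by (simp add: ennreal_power)
qed

text \<open>
  If the overlap is the fraction \<open>r ^ n\<close> of the volume, every \<open>u\<close> with \<open>x \<in> (1 - u) U\<close> is at most \<open>r\<close>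
  by the previous lemma, so the weights of all such \<open>u\<close> add up to at most \<open>r ^ n\<close>. The membership
  is written as \<open>x / (1 - u) \<in> U\<close> to be measurable in \<open>(x, u)\<close> for open \<open>U\<close>.
\<close>

lemma overlap_weight_bound:
  fixes A :: "'a::euclidean_space set"
  assumes A: "convex A" and fin: "emeasure lebesgue (interior A) < \<infinity>" 
    and U: "U \<subseteq> difference_body A"
  defines "n \<equiv> DIM('a)"
  shows "emeasure lebesgue (interior A) *
    (\<integral>\<^sup>+u. ennreal (real n * u ^ (n - 1)) * indicator {0<..<1} u * indicator U ((1 / (1 - u)) *\<^sub>R x) \<partial>lborel)
    \<le> emeasure lebesgue {y \<in> interior A. x + y \<in> interior A}"
    (is "?v * ?I \<le> ?g")
proof (cases "?v = 0")
  case False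
  have n: "0 < n" by (simp add: n_def)
  obtain v where v: "?v = ennreal v" "0 \<le> v" using fin by (cases "?v") auto
  have vpos: "0 < v" using False v by (auto simp: less_le)
  have "?g \<le> ?v" by (intro emeasure_mono) auto
  then obtain g where g: "?g = ennreal g" "0 \<le> g" using fin by (cases "?g") (auto simp: top_unique)
  define r where "r = root n (g / v)"
  have r: "0 \<le> r" "r ^ n = g / v"
    using g vpos n by (auto simp: r_def)
  have "u \<le> r" if "u \<in> {0<..<1}" "(1 / (1 - u)) *\<^sub>R x \<in> U" for u :: real
  proof -
    have "x = (1 - u) *\<^sub>R ((1 / (1 - u)) *\<^sub>R x)" using that(1) by simp
    then have "x \<in> (*\<^sub>R) (1 - u) ` difference_body A" using that(2) U by blast
    then have "ennreal (u ^ n) * ennreal v \<le> ennreal g"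
      using overlap_lower_bound[OF A, of u x] that(1) unfolding n_def v(1) g(1) by auto
    then have "u ^ n * v \<le> g"
      using that(1) g(2) vpos by (simp add: ennreal_mult'[symmetric])
    then have "u ^ n \<le> r ^ n"
      using vpos by (simp add: r(2) field_simps)
    then show "u \<le> r" using power_mono_iff[of u r n] r(1) that(1) n by simp
  qed
  then have "?I \<le> (\<integral>\<^sup>+u. ennreal (real n * u ^ (n - 1)) * indicator {0..r} u \<partial>lborel)"
    by (intro nn_integral_mono) (auto simp: indicator_def)
  also have "\<dots> = ennreal (g / v)"
    using nn_integral_power_weight[OF r(1) n] r(2) by simp
  finally have "?v * ?I \<le> ennreal v * ennreal (g / v)"
    unfolding v(1) by (rule mult_left_mono) simp
  also have "\<dots> = ?g"
    using vpos g by (simp add: ennreal_mult'[symmetric])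
  finally show ?thesis .
qed simp

text \<open>
  The bound \<open>\<mu>(c U) \<ge> c^n \<mu>(U)\<close>: the substitution \<open>x = c y\<close> produces \<open>c^n\<close> and the density \<open>\<phi>(c y)\<close>,
  which dominates \<open>\<phi>(y)\<close>.
\<close>

lemma radially_decreasing_nn_integral_scaleR:
  fixes \<phi> :: "'a::euclidean_space \<Rightarrow> real"
  assumes \<phi>: "\<phi> \<in> borel_measurable lebesgue" "radially_decreasing \<phi>"
    and U: "open U" and c: "0 < c" "c \<le> 1"
  shows "ennreal (c ^ DIM('a)) * (\<integral>\<^sup>+x. ennreal (\<phi> x) * indicator U x \<partial>lebesgue)
    \<le> (\<integral>\<^sup>+x. ennreal (\<phi> x) * indicator U ((1 / c) *\<^sub>R x) \<partial>lebesgue)"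
proof -
  note [measurable] = \<phi>(1)
  have [measurable]: "U \<in> sets borel" using U by simp
  have ind: "(\<lambda>x. indicator U ((1 / c) *\<^sub>R x) :: ennreal) \<in> borel_measurable lebesgue"
    by (rule measurable_completion) measurable
  have "(\<integral>\<^sup>+x. ennreal (\<phi> x) * indicator U ((1 / c) *\<^sub>R x) \<partial>lebesgue) =
      ennreal (c ^ DIM('a)) * (\<integral>\<^sup>+x. ennreal (\<phi> (c *\<^sub>R x)) * indicator U ((1 / c) *\<^sub>R c *\<^sub>R x) \<partial>lebesgue)"
    using ind c by (intro nn_integral_lebesgue_scaleR) auto
  also have "\<dots> \<ge> ennreal (c ^ DIM('a)) * (\<integral>\<^sup>+x. ennreal (\<phi> x) * indicator U x \<partial>lebesgue)"
    using c \<phi>(2) unfolding radially_decreasing_def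
    by (intro mult_left_mono nn_integral_mono mult_mono ennreal_leI) auto
  finally show ?thesis .
qed

text \<open>
  For \<open>\<phi> = 1\<close> and bounded \<open>A\<close> this is the classical Rogers--Shephard inequality for the volume of the
  difference body.
\<close>

lemma emeasure_difference_body_le:
  fixes A :: "'a::euclidean_space set" and \<phi> :: "'a \<Rightarrow> real"
  assumes A: "convex A" and fin: "emeasure lebesgue A < \<infinity>"
    and \<phi>: "\<phi> \<in> borel_measurable lebesgue" "radially_decreasing \<phi>"
  defines "M \<equiv> density lebesgue (\<lambda>x. ennreal (\<phi> x))"
  shows "emeasure M (difference_body A)
    \<le> of_nat ((2 * DIM('a)) choose DIM('a)) * translate_average M A"
proof (cases "emeasure lebesgue A = 0")
  case True
  have "A \<in> null_sets lebesgue"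
    using True convex_sets_lebesgue[OF A] by auto
  then have "difference_body A \<in> null_sets lebesgue"
    using negligible_difference_body[OF A] by (simp add: negligible_iff_null_sets)
  then have "emeasure M (difference_body A) = 0"
    unfolding M_def using \<phi>(1) absolutely_continuousI_density[of "\<lambda>x. ennreal (\<phi> x)" lebesgue]
    by (auto simp: absolutely_continuous_def)
  then show ?thesis by simp
next
  case False
  note [measurable] = \<phi>(1)
  define n where "n = DIM('a)"
  define K where "K = interior A"
  define U where "U = interior (difference_body A)"
  define w where "w u = ennreal (real n * u ^ (n - 1)) * indicator {0<..<1} u" for u :: real
  define v where "v = emeasure lebesgue A"
  have n: "0 < n" by (simp add: n_def)
  have [measurable]: "K \<in> sets borel" "U \<in> sets borel" "open U"
    by (auto simp: K_def U_def)
  have [measurable]: "w \<in> borel_measurable borel" unfolding w_def by measurable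
  have vK: "emeasure lebesgue K = v"
    unfolding K_def v_def by (rule emeasure_lebesgue_interior_convex[OF A])
  interpret leb: sigma_finite_measure "lebesgue :: 'a measure" by (rule sigma_finite_lebesgue)
  interpret ll: pair_sigma_finite "lebesgue :: 'a measure" "lebesgue :: 'a measure" ..
  interpret lb: pair_sigma_finite "lebesgue :: 'a measure" "lborel :: real measure" ..
  have id[measurable]: "(\<lambda>x. x) \<in> lebesgue \<rightarrow>\<^sub>M (borel :: 'a measure)"
    by (rule measurable_completion) measurable
  have fst1[measurable]: "fst \<in> (lebesgue :: 'a measure) \<Otimes>\<^sub>M N \<rightarrow>\<^sub>M borel" for N :: "'b measure"
    using measurable_compose[OF measurable_fst id] by simp
  have snd1[measurable]: "snd \<in> N \<Otimes>\<^sub>M (lebesgue :: 'a measure) \<rightarrow>\<^sub>M borel" for N :: "'b measure"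
    using measurable_compose[OF measurable_snd id] by simp
  define N where "N = (\<integral>\<^sup>+y\<in>A. emeasure M ((\<lambda>x. - y + x) ` A) \<partial>lebesgue)"
  have D: "difference_body A \<in> sets lebesgue"
    by (intro convex_sets_lebesgue convex_difference_body A)
  have MU: "emeasure M (difference_body A) = (\<integral>\<^sup>+x. ennreal (\<phi> x) * indicator U x \<partial>lebesgue)"
  proof -
    have "emeasure M (difference_body A) = (\<integral>\<^sup>+x. ennreal (\<phi> x) * indicator (difference_body A) x \<partial>lebesgue)"
      unfolding M_def using D by (intro emeasure_density) auto
    also have "\<dots> = (\<integral>\<^sup>+x. ennreal (\<phi> x) * indicator U x \<partial>lebesgue)"
    proof (rule nn_integral_null_delta[OF D])
      show "U \<in> sets lebesgue" by auto
      have "difference_body A - U \<union> (U - difference_body A) = difference_body A - interior (difference_body A)"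
        using interior_subset unfolding U_def by blast
      then show "difference_body A - U \<union> (U - difference_body A) \<in> null_sets lebesgue"
        using convex_diff_interior_null_sets[OF convex_difference_body[OF A]] by simp
    qed
    finally show ?thesis .
  qed
  have inner: "v * (\<integral>\<^sup>+u. w u * indicator U ((1 / (1 - u)) *\<^sub>R x) \<partial>lborel)
      \<le> (\<integral>\<^sup>+y. indicator K (x + y) * indicator K y \<partial>lebesgue)" for x
  proof -
    have "v * (\<integral>\<^sup>+u. w u * indicator U ((1 / (1 - u)) *\<^sub>R x) \<partial>lborel)
        \<le> emeasure lebesgue {y \<in> interior A. x + y \<in> interior A}"
      using overlap_weight_bound[OF A, of U x] fin interior_subset[of "difference_body A"]
      unfolding w_def U_def n_def vK[symmetric] K_def
      by (simp add: emeasure_lebesgue_interior_convex[OF A] del: emeasure_completion)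
    also have "\<dots> = (\<integral>\<^sup>+y. indicator {y \<in> K. x + y \<in> K} y \<partial>lebesgue)"
    proof (subst nn_integral_indicator)
      have "{y \<in> K. x + y \<in> K} \<in> sets borel" by measurable
      then show "{y \<in> K. x + y \<in> K} \<in> sets lebesgue" by auto
    qed (simp add: K_def)
    also have "\<dots> = (\<integral>\<^sup>+y. indicator K (x + y) * indicator K y \<partial>lebesgue)"
      by (intro nn_integral_cong) (auto simp: indicator_def)
    finally show ?thesis .
  qed
  \<comment> \<open>From the Beta integral times \<open>\<mu>(D)\<close> up to the unnormalised average: radial decrease, Tonelli in
    \<open>(x, u)\<close>, the overlap bound, Tonelli in \<open>(x, y)\<close>.\<close>
  have "v * ((\<integral>\<^sup>+u. ennreal (real n * u ^ (n - 1)) * ennreal ((1 - u) ^ n) * indicator {0<..<1} u \<partial>lborel) *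
      emeasure M (difference_body A))
    = v * (\<integral>\<^sup>+u. w u * (ennreal ((1 - u) ^ n) * (\<integral>\<^sup>+x. ennreal (\<phi> x) * indicator U x \<partial>lebesgue)) \<partial>lborel)"
    unfolding MU w_def
    by (subst nn_integral_multc[symmetric]) (auto simp: mult_ac intro!: arg_cong2[of _ _ _ _ "(*)"] nn_integral_cong)
  also have "\<dots> \<le> v * (\<integral>\<^sup>+u. w u * (\<integral>\<^sup>+x. ennreal (\<phi> x) * indicator U ((1 / (1 - u)) *\<^sub>R x) \<partial>lebesgue) \<partial>lborel)"
  proof (rule mult_left_mono, rule nn_integral_mono)
    fix u :: real
    show "w u * (ennreal ((1 - u) ^ n) * (\<integral>\<^sup>+x. ennreal (\<phi> x) * indicator U x \<partial>lebesgue))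
      \<le> w u * (\<integral>\<^sup>+x. ennreal (\<phi> x) * indicator U ((1 / (1 - u)) *\<^sub>R x) \<partial>lebesgue)"
    proof (cases "u \<in> {0<..<1}")
      case True
      then show ?thesis
        unfolding n_def
        by (intro mult_left_mono radially_decreasing_nn_integral_scaleR \<phi> \<open>open U\<close>) auto
    qed (simp add: w_def)
  qed simp
  also have "\<dots> = v * (\<integral>\<^sup>+u. \<integral>\<^sup>+x. w u * (ennreal (\<phi> x) * indicator U ((1 / (1 - u)) *\<^sub>R x)) \<partial>lebesgue \<partial>lborel)"
    by (subst nn_integral_cmult) auto
  also have "\<dots> = v * (\<integral>\<^sup>+x. \<integral>\<^sup>+u. w u * (ennreal (\<phi> x) * indicator U ((1 / (1 - u)) *\<^sub>R x)) \<partial>lborel \<partial>lebesgue)"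
    by (subst lb.Fubini') auto
  also have "\<dots> = (\<integral>\<^sup>+x. ennreal (\<phi> x) * (v * (\<integral>\<^sup>+u. w u * indicator U ((1 / (1 - u)) *\<^sub>R x) \<partial>lborel)) \<partial>lebesgue)"
    by (simp add: nn_integral_cmult[symmetric] mult_ac)
  also have "\<dots> \<le> (\<integral>\<^sup>+x. ennreal (\<phi> x) * (\<integral>\<^sup>+y. indicator K (x + y) * indicator K y \<partial>lebesgue) \<partial>lebesgue)"
    by (intro nn_integral_mono mult_left_mono inner) simp
  also have "\<dots> = (\<integral>\<^sup>+x. \<integral>\<^sup>+y. ennreal (\<phi> x) * (indicator K (x + y) * indicator K y) \<partial>lebesgue \<partial>lebesgue)"
    by (subst nn_integral_cmult) auto
  also have "\<dots> = (\<integral>\<^sup>+y. \<integral>\<^sup>+x. ennreal (\<phi> x) * (indicator K (x + y) * indicator K y) \<partial>lebesgue \<partial>lebesgue)"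
    by (subst ll.Fubini') auto
  also have "\<dots> \<le> N"
    unfolding N_def
  proof (intro nn_integral_mono)
    fix y :: 'a
    have img: "(\<lambda>x. - y + x) ` A \<in> sets lebesgue"
      by (intro lebesgue_sets_translation convex_sets_lebesgue A)
    have "(\<integral>\<^sup>+x. ennreal (\<phi> x) * (indicator K (x + y) * indicator K y) \<partial>lebesgue)
        \<le> (\<integral>\<^sup>+x. ennreal (\<phi> x) * indicator ((\<lambda>x. - y + x) ` A) x * indicator A y \<partial>lebesgue)"
    proof (intro nn_integral_mono)
      fix x :: 'a
      have "x \<in> (\<lambda>x. - y + x) ` A" if "x + y \<in> A"
        using that by (intro image_eqI[of _ _ "x + y"]) auto
      then show "ennreal (\<phi> x) * (indicator K (x + y) * indicator K y)
          \<le> ennreal (\<phi> x) * indicator ((\<lambda>x. - y + x) ` A) x * indicator A y"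
        using interior_subset[of A] unfolding K_def by (auto simp: indicator_def)
    qed
    also have "\<dots> = (\<integral>\<^sup>+x. ennreal (\<phi> x) * indicator ((\<lambda>x. - y + x) ` A) x \<partial>lebesgue) * indicator A y"
      using img by (intro nn_integral_multc) auto
    also have "\<dots> = emeasure M ((\<lambda>x. - y + x) ` A) * indicator A y"
      unfolding M_def using img by (subst emeasure_density) auto
    finally show "(\<integral>\<^sup>+x. ennreal (\<phi> x) * (indicator K (x + y) * indicator K y) \<partial>lebesgue)
        \<le> emeasure M ((\<lambda>x. - y + x) ` A) * indicator A y" .
  qed
  finally have main: "v * ((\<integral>\<^sup>+u. ennreal (real n * u ^ (n - 1)) * ennreal ((1 - u) ^ n) * indicator {0<..<1} u \<partial>lborel) *
      emeasure M (difference_body A)) \<le> N" (is "v * (?B * ?m) \<le> N") .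
  have "v \<noteq> 0" "v \<noteq> top"
    using False fin unfolding v_def by auto
  then have "?B * ?m = v * (?B * ?m) / v"
    by (subst mult.commute[of v]) (rule ennreal_mult_divide_eq[symmetric])
  also have "\<dots> \<le> translate_average M A"
    using main False by (simp add: translate_average_def N_def v_def divide_right_mono_ennreal del: emeasure_completion)
  finally have "of_nat ((2 * n) choose n) * (?B * ?m) \<le> of_nat ((2 * n) choose n) * translate_average M A"
    by (intro mult_left_mono) auto
  then show ?thesis
    using nn_integral_beta_weight[OF n] by (simp add: mult.assoc[symmetric] n_def[symmetric])
qed

text \<open>
  By translation invariance the average is that of a constant; this is an equality except
  when the volume is infinite, where the quotient \<open>\<infinity> / \<infinity>\<close> is 0.
\<close>

lemma translate_average_lebesgue_le:
  fixes A :: "'a::euclidean_space set"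
  assumes "A \<in> sets lebesgue"
  shows "translate_average lebesgue A \<le> emeasure lebesgue A"
proof (cases "emeasure lebesgue A = 0")
  case False
  have "emeasure lebesgue ((\<lambda>x. - y + x) ` A) = emeasure lebesgue A" for y
    using emeasure_lebesgue_affine[of 1 "- y" A] by (simp add: add.commute del: emeasure_completion)
  then have "(\<integral>\<^sup>+y\<in>A. emeasure lebesgue ((\<lambda>x. - y + x) ` A) \<partial>lebesgue) =
      emeasure lebesgue A * emeasure lebesgue A"
    using assms by (simp add: nn_integral_cmult_indicator del: emeasure_completion)
  then show ?thesis
    using False unfolding translate_average_def
    by (auto intro!: divide_le_posI_ennreal simp: zero_less_iff_neq_zero simp del: emeasure_completion)
qed (simp add: translate_average_def)

section \<open>Layer cakes\<close>

text \<open>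
  Layer cake formulas arise from Tonelli for the region \<open>P\<close> under a graph. The predicate is kept
  general because the difference function needs its strict levels, which are difference bodies,
  whereas \<open>f\<close> itself enters through its closed levels.
\<close>

lemma nn_integral_slices:
  assumes "sigma_finite_measure M" and P: "Measurable.pred (M \<Otimes>\<^sub>M lborel) (case_prod P)"
  shows "(\<integral>\<^sup>+x. emeasure lborel {t. P x t} \<partial>M) = (\<integral>\<^sup>+t. emeasure M {x \<in> space M. P x t} \<partial>lborel)"
    and "(\<lambda>t::real. emeasure M {x \<in> space M. P x t}) \<in> borel_measurable borel"
proof -
  interpret sigma_finite_measure M by fact
  interpret pair_sigma_finite M "lborel :: real measure" ..
  note [measurable] = P
  have Q[measurable]: "Measurable.pred (lborel \<Otimes>\<^sub>M M) (\<lambda>(t, x). P x t)"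
    using measurable_compose[OF measurable_pair_swap' P] by (simp add: case_prod_unfold)
  have Px: "{t. P x t} \<in> sets lborel" if "x \<in> space M" for x
    using measurable_compose[OF measurable_Pair1'[OF that] P] by (simp add: pred_def)
  have Pt: "{x \<in> space M. P x t} \<in> sets M" for t
    using measurable_compose[OF measurable_Pair2'[of t lborel M] P] by (simp add: pred_def)
  have ind: "(\<lambda>(x, t). if P x t then 1 else 0 :: ennreal) \<in> borel_measurable (M \<Otimes>\<^sub>M lborel)"
    using P by (simp add: case_prod_unfold)
  have ind': "(\<lambda>(t, x). if P x t then 1 else 0 :: ennreal) \<in> borel_measurable (lborel \<Otimes>\<^sub>M M)"
    using Q by (simp add: case_prod_unfold)
  have 1: "emeasure lborel {t. P x t} = (\<integral>\<^sup>+t. (if P x t then 1 else 0) \<partial>lborel)" if "x \<in> space M" for x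
    unfolding nn_integral_indicator[OF Px[OF that], symmetric]
    by (auto intro!: nn_integral_cong)
  have 2: "emeasure M {x \<in> space M. P x t} = (\<integral>\<^sup>+x. (if P x t then 1 else 0) \<partial>M)" for t
    using nn_integral_indicator[OF Pt, of t]
    by (simp add: indicator_def of_bool_def cong: nn_integral_cong)
  show "(\<integral>\<^sup>+x. emeasure lborel {t. P x t} \<partial>M) = (\<integral>\<^sup>+t. emeasure M {x \<in> space M. P x t} \<partial>lborel)"
    unfolding 2 using Fubini'[OF ind] by (simp add: 1 cong: nn_integral_cong)
  show "(\<lambda>t::real. emeasure M {x \<in> space M. P x t}) \<in> borel_measurable borel"
    unfolding 2 using sigma_finite_measure.borel_measurable_nn_integral[OF assms(1) ind'] by simp
qed

lemma emeasure_lborel_Ioi: "emeasure lborel {a::real<..} = \<infinity>"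
proof -
  have "ennreal (real k) \<le> emeasure lborel {a<..}" for k
  proof -
    have "emeasure lborel {a<..<a + real k} \<le> emeasure lborel {a<..}"
      by (intro emeasure_mono) auto
    then show ?thesis by simp
  qed
  then show ?thesis
    by (metis ennreal_of_nat_eq_real_of_nat ennreal_SUP_of_nat_eq_top infinity_ennreal_def SUP_le_iff UNIV_I top_unique)
qed

lemma emeasure_below_ennreal: "emeasure lborel {t::real. 0 < t \<and> ennreal t < a} = a"
proof (cases a)
  case (real r)
  then have "{t::real. 0 < t \<and> ennreal t < a} = {0<..<r}"
    by (auto simp: ennreal_less_iff)
  then show ?thesis using real by simp
next
  case top
  then have "{t::real. 0 < t \<and> ennreal t < a} = {0<..}"
    by auto
  then show ?thesis using top emeasure_lborel_Ioi by simp
qed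

text \<open>
  The factor leaves the integral although \<open>h\<close> may be nonmeasurable, since only \<open>g / c\<close> is integrated.
  Here \<open>h\<close> will be the average over the superlevel set as a function of the level.
\<close>

lemma nn_integral_le_cmult:
  assumes g: "g \<in> borel_measurable M" and le: "\<And>x. x \<in> space M \<Longrightarrow> g x \<le> c * h x"
    and c: "c \<noteq> 0" "c < (\<infinity> :: ennreal)"
  shows "(\<integral>\<^sup>+x. g x \<partial>M) \<le> c * (\<integral>\<^sup>+x. h x \<partial>M)"
proof -
  have "(\<integral>\<^sup>+x. g x \<partial>M) = (\<integral>\<^sup>+x. c * (g x / c) \<partial>M)"
    using c by (intro nn_integral_cong) (simp add: ennreal_times_divide mult.commute[of c] ennreal_mult_divide_eq)
  also have "\<dots> = c * (\<integral>\<^sup>+x. g x / c \<partial>M)"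
    using g by (intro nn_integral_cmult) simp
  also have "\<dots> \<le> c * (\<integral>\<^sup>+x. h x \<partial>M)"
    using c le by (intro mult_left_mono nn_integral_mono divide_le_posI_ennreal) (auto simp: zero_less_iff_neq_zero)
  finally show ?thesis .
qed

section \<open>The functional inequality\<close>

text \<open>
  For strict levels the supremum exceeds \<open>a\<close> iff a single pair does, which makes this an equality.
\<close>

lemma min_difference_superlevel:
  "{z. a < min_difference f z} = difference_body {x. a < ennreal (f x)}"
proof -
  have "a < ennreal (min p q) \<longleftrightarrow> a < ennreal p \<and> a < ennreal q" for p q :: real
    by (auto simp: min_def) (metis ennreal_leI order_less_le_trans linear)+
  then show ?thesis
    unfolding min_difference_def difference_body_def less_SUP_iff by fastforce
qed

lemma quasi_concave_convex_Collect:
  assumes f: "quasi_concave f" and P: "\<And>p q. P p \<Longrightarrow> p \<le> q \<Longrightarrow> P q"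
  shows "convex {x. P (f x)}"
  unfolding convex_alt
proof clarsimp
  fix x y u assume *: "P (f x)" "P (f y)" "0 \<le> (u::real)" "u \<le> 1"
  show "P (f ((1 - u) *\<^sub>R x + u *\<^sub>R y))"
  proof (cases "u \<in> {0<..<1}")
    case True
    have "P (min (f x) (f y))" using * by (simp add: min_def)
    then show ?thesis using f True P unfolding quasi_concave_def by blast
  next
    case False
    then have "u = 0 \<or> u = 1" using * by auto
    then show ?thesis using * by auto
  qed
qed

lemma borel_measurable_min_difference:
  fixes f :: "'a::euclidean_space \<Rightarrow> real"
  assumes "quasi_concave f"
  shows "min_difference f \<in> borel_measurable lebesgue"
proof (rule borel_measurableI_greater)
  fix a
  have "convex {x. a < ennreal (f x)}"
    by (rule quasi_concave_convex_Collect[OF assms]) (metis ennreal_leI order_less_le_trans)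
  then show "{z \<in> space lebesgue. a < min_difference f z} \<in> sets lebesgue"
    by (simp add: min_difference_superlevel convex_sets_lebesgue convex_difference_body)
qed

lemma emeasure_superlevel_finite:
  fixes f :: "'a \<Rightarrow> real"
  assumes f: "integrable M f" and t: "0 < t"
  shows "emeasure M {x \<in> space M. t \<le> f x} < \<infinity>"
proof -
  have fin: "(\<integral>\<^sup>+x. ennreal (f x) \<partial>M) < \<infinity>"
    using f by (simp add: real_integrable_def less_top)
  have "t \<le> r \<longleftrightarrow> 1 \<le> ennreal (1 / t) * ennreal r" for r
    using t by (cases "0 \<le> r") (auto simp: ennreal_mult'[symmetric] ennreal_neg simp del: ennreal_1 simp: ennreal_1[symmetric] field_simps)
  then have "emeasure M {x \<in> space M. t \<le> f x} =
      emeasure M {x \<in> space M. 1 \<le> ennreal (1 / t) * ennreal (f x)}" by presburger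
  also have "\<dots> \<le> ennreal (1 / t) * (\<integral>\<^sup>+x. ennreal (f x) * indicator (space M) x \<partial>M)"
    using f by (intro nn_integral_Markov_inequality) auto
  also have "\<dots> < \<infinity>"
    using fin by (simp add: ennreal_mult_less_top cong: nn_integral_cong)
  finally show ?thesis .
qed

text \<open>
  The inequality for sets is applied at every level \<open>t > 0\<close> to both \<open>{f \<ge> t}\<close> and its reflection, and
  integrated over \<open>t\<close>.
\<close>

theorem min_difference_Rogers_Shephard:
  fixes f \<phi> :: "'a::euclidean_space \<Rightarrow> real"
  assumes f: "integrable lebesgue f" "quasi_concave f"
    and \<phi>: "\<phi> \<in> borel_measurable lebesgue" "radially_decreasing \<phi>"
  defines "M \<equiv> density lebesgue (\<lambda>x. ennreal (\<phi> x))"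
  shows "(\<integral>\<^sup>+x. min_difference f x \<partial>M) \<le> of_nat ((2 * DIM('a)) choose DIM('a)) *
    (\<integral>\<^sup>+t\<in>{0<..}. min (translate_average M (superlevel f t))
                      (translate_average M (uminus ` superlevel f t)) \<partial>lebesgue)"
proof -
  let ?C = "of_nat ((2 * DIM('a)) choose DIM('a)) :: ennreal"
  let ?m = "\<lambda>t. min (translate_average M (superlevel f t)) (translate_average M (uminus ` superlevel f t))"
  let ?P = "\<lambda>x t. 0 < t \<and> ennreal t < min_difference f x"
  note [measurable] = \<phi>(1)
  interpret leb: sigma_finite_measure "lebesgue :: 'a measure" by (rule sigma_finite_lebesgue)
  have M: "sigma_finite_measure M"
    unfolding M_def by (subst leb.sigma_finite_iff_density_finite) auto
  have [measurable]: "min_difference f \<in> borel_measurable M"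
    unfolding M_def using borel_measurable_min_difference[OF f(2)] by simp
  have P: "Measurable.pred (M \<Otimes>\<^sub>M lborel) (case_prod ?P)"
    by measurable
  have lev: "emeasure M {x \<in> space M. ?P x t} \<le> ?C * (?m t * indicator {0<..} t)" for t
  proof (cases "0 < t")
    case True
    let ?A = "superlevel f t"
    have A: "convex ?A"
      unfolding superlevel_def by (rule quasi_concave_convex_Collect[OF f(2)]) auto
    have fin: "emeasure lebesgue ?A < \<infinity>"
      using emeasure_superlevel_finite[OF f(1) True] by (simp add: superlevel_def)
    have A': "convex (uminus ` ?A)"
      using A by (rule convex_negations)
    have fin': "emeasure lebesgue (uminus ` ?A) < \<infinity>"
      using fin emeasure_lebesgue_affine[of "-1" 0 ?A] by (simp del: emeasure_completion)
    have D: "difference_body ?A \<in> sets M"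
      unfolding M_def using A by (simp add: convex_sets_lebesgue convex_difference_body)
    have "{x. ennreal t < ennreal (f x)} \<subseteq> ?A"
      using True by (auto simp: superlevel_def ennreal_less_iff)
    then have "{x \<in> space M. ?P x t} \<subseteq> difference_body ?A"
      using difference_body_mono min_difference_superlevel[of "ennreal t" f] by blast
    then have "emeasure M {x \<in> space M. ?P x t} \<le> emeasure M (difference_body ?A)"
      by (rule emeasure_mono[OF _ D])
    moreover have "emeasure M (difference_body ?A) \<le> ?C * translate_average M ?A"
      unfolding M_def by (rule emeasure_difference_body_le[OF A fin \<phi>])
    moreover have "emeasure M (difference_body ?A) \<le> ?C * translate_average M (uminus ` ?A)"
      using emeasure_difference_body_le[OF A' fin' \<phi>] unfolding M_def difference_body_uminus .
    ultimately show ?thesis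
      using True by (auto simp: min_def)
  qed simp
  have "(\<integral>\<^sup>+x. min_difference f x \<partial>M) = (\<integral>\<^sup>+t. emeasure M {x \<in> space M. ?P x t} \<partial>lborel)"
    using nn_integral_slices(1)[OF M P] by (simp add: emeasure_below_ennreal)
  also have "\<dots> \<le> ?C * (\<integral>\<^sup>+t. ?m t * indicator {0<..} t \<partial>lborel)"
    using nn_integral_slices(2)[OF M P] lev
    by (intro nn_integral_le_cmult) (auto simp: of_nat_less_top)
  finally show ?thesis
    by (simp add: nn_integral_completion)
qed

lemma nn_integral_superlevel:
  fixes f :: "'a::euclidean_space \<Rightarrow> real"
  assumes [measurable]: "f \<in> borel_measurable lebesgue"
  shows "(\<integral>\<^sup>+t\<in>{0<..}. emeasure lebesgue (superlevel f t) \<partial>lebesgue) = (\<integral>\<^sup>+x. ennreal (f x) \<partial>lebesgue)"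
proof -
  let ?P = "\<lambda>(x::'a) t. 0 < t \<and> t \<le> f x"
  have P: "Measurable.pred (lebesgue \<Otimes>\<^sub>M lborel) (case_prod ?P)"
    by measurable
  have "{t. ?P x t} = {0<..f x}" for x by auto
  then have "emeasure lborel {t. ?P x t} = ennreal (f x)" for x
    by (cases "0 \<le> f x") (auto simp: ennreal_neg)
  moreover have "emeasure lebesgue {x. ?P x t} = emeasure lebesgue (superlevel f t) * indicator {0<..} t" for t
    by (cases "0 < t") (auto simp: superlevel_def simp del: emeasure_completion)
  ultimately show ?thesis
    using nn_integral_slices(1)[OF sigma_finite_lebesgue P]
    by (simp add: nn_integral_completion del: emeasure_completion)
qed

theorem theorem2p3:
  fixes f :: "real ^ 'n \<Rightarrow> real"
  assumes "\<And>x. 0 \<le> f x"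
    and "integrable lebesgue f"
    and "quasi_concave f"
  shows "(\<forall>\<phi> :: real ^ 'n \<Rightarrow> real.
           (\<forall>x. 0 \<le> \<phi> x) \<and> \<phi> \<in> borel_measurable lebesgue \<and> radially_decreasing \<phi> \<longrightarrow>
           (let \<mu> = density lebesgue (\<lambda>x. ennreal (\<phi> x)) in
             (\<integral>\<^sup>+x. min_difference f x \<partial>\<mu>) \<le>
               of_nat ((2 * CARD('n)) choose CARD('n)) *
               (\<integral>\<^sup>+t\<in>{0<..}. min (translate_average \<mu> (superlevel f t))
                                 (translate_average \<mu> (uminus ` superlevel f t)) \<partial>lebesgue)))
       \<and> (\<integral>\<^sup>+x. min_difference f x \<partial>lebesgue) \<le>
           of_nat ((2 * CARD('n)) choose CARD('n)) * (\<integral>\<^sup>+x. ennreal (f x) \<partial>lebesgue)"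
proof (intro conjI allI impI)
  fix \<phi> :: "real ^ 'n \<Rightarrow> real"
  assume "(\<forall>x. 0 \<le> \<phi> x) \<and> \<phi> \<in> borel_measurable lebesgue \<and> radially_decreasing \<phi>"
  then show "let \<mu> = density lebesgue (\<lambda>x. ennreal (\<phi> x)) in
      (\<integral>\<^sup>+x. min_difference f x \<partial>\<mu>) \<le> of_nat ((2 * CARD('n)) choose CARD('n)) *
        (\<integral>\<^sup>+t\<in>{0<..}. min (translate_average \<mu> (superlevel f t))
                          (translate_average \<mu> (uminus ` superlevel f t)) \<partial>lebesgue)"
    using min_difference_Rogers_Shephard[OF assms(2,3), of \<phi>] unfolding Let_def by simp
next
  \<comment> \<open>Lebesgue measure has the density 1, and the average over a set is then at most its volume.\<close>
  have one: "radially_decreasing (\<lambda>x :: real ^ 'n. 1 :: real)"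
    by (simp add: radially_decreasing_def)
  have dens: "density lebesgue (\<lambda>x :: real ^ 'n. ennreal 1) = lebesgue"
    by (simp add: density_1)
  have meas: "superlevel f t \<in> sets lebesgue" for t
    unfolding superlevel_def
    by (intro convex_sets_lebesgue quasi_concave_convex_Collect[OF assms(3)]) auto
  have "(\<integral>\<^sup>+x. min_difference f x \<partial>lebesgue) \<le> of_nat ((2 * CARD('n)) choose CARD('n)) *
      (\<integral>\<^sup>+t\<in>{0<..}. min (translate_average lebesgue (superlevel f t))
                        (translate_average lebesgue (uminus ` superlevel f t)) \<partial>lebesgue)"
    using min_difference_Rogers_Shephard[OF assms(2,3) _ one] unfolding dens by simp
  also have "\<dots> \<le> of_nat ((2 * CARD('n)) choose CARD('n)) *
      (\<integral>\<^sup>+t\<in>{0<..}. emeasure lebesgue (superlevel f t) \<partial>lebesgue)"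
    by (intro mult_left_mono nn_integral_mono mult_right_mono min.coboundedI1
        translate_average_lebesgue_le meas) auto
  also have "\<dots> = of_nat ((2 * CARD('n)) choose CARD('n)) * (\<integral>\<^sup>+x. ennreal (f x) \<partial>lebesgue)"
    using assms(2) by (subst nn_integral_superlevel) auto
  finally show "(\<integral>\<^sup>+x. min_difference f x \<partial>lebesgue) \<le>
      of_nat ((2 * CARD('n)) choose CARD('n)) * (\<integral>\<^sup>+x. ennreal (f x) \<partial>lebesgue)" .
qed

end
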